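(* Let $T$ be a triangle in the plane and let $T'\supseteq T$ be one of its minimum area isosceles containers. Then $T'$ and $T$ have a side in common, and their angles at one of the endpoints of this common side are equal.
   Context: Triangles are non-degenerate closed triangular regions in the plane. An isosceles triangle is one with at least two sides of equal length (equilateral triangles included). An isosceles container for a triangle $T$ is an isosceles triangle $T'$ with $T\subseteq T'$. A minimum area isosceles container for $T$ is an isosceles container for $T$ whose area is smaller than or equal to the area of every other isosceles container for $T$. *)

theory Defs
  imports "HOL-Analysis.Analysis"
begin

(* The vertices of a triangle are its extreme points, so a, b, c are determined by S up to order. *)
definition triangle_with_vertices ::
  "(real^2) set \<Rightarrow> real^2 \<Rightarrow> real^2 \<Rightarrow> real^2 \<Rightarrow> bool" where
  "triangle_with_vertices S a b c \<longleftrightarrow> \<not> collinear {a, b, c} \<and> S = convex hull {a, b, c}"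

definition is_triangle :: "(real^2) set \<Rightarrow> bool" where
  "is_triangle S \<longleftrightarrow> (\<exists>a b c. triangle_with_vertices S a b c)"

definition isosceles_triangle :: "(real^2) set \<Rightarrow> bool" where
  "isosceles_triangle S \<longleftrightarrow> (\<exists>a b c. triangle_with_vertices S a b c \<and> dist a b = dist a c)"

definition isosceles_container :: "(real^2) set \<Rightarrow> (real^2) set \<Rightarrow> bool" where
  "isosceles_container T T' \<longleftrightarrow> isosceles_triangle T' \<and> T \<subseteq> T'"

definition min_area_isosceles_container :: "(real^2) set \<Rightarrow> (real^2) set \<Rightarrow> bool" where
  "min_area_isosceles_container T T' \<longleftrightarrow>
     isosceles_container T T' \<and> (\<forall>S. isosceles_container T S \<longrightarrow> measure lborel T' \<le> measure lborel S)"

(* The unsigned angle between the rays from the middle argument b to a and to c, in [0, pi];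
   only meaningful if a and c differ from b. *)
definition angle_at :: "real^2 \<Rightarrow> real^2 \<Rightarrow> real^2 \<Rightarrow> real" where
  "angle_at a b c = arccos (((a - b) \<bullet> (c - b)) / (norm (a - b) * norm (c - b)))"

end

theory Submission
  imports Defs
begin

text \<open>
  Rotating a container of fixed shape about the vertices of the triangle that its three sides touch
  changes its size by a factor that is sinusoidal, hence strictly concave, in the angle. So in a container
  of minimum area some side contains a whole side of the triangle.

  Take this side as first coordinate axis. If the container does not share a side and an angle with the
  triangle, there is room to change its shape within a one-parameter family of isosceles containers. The
  derivative of the area vanishes only in a few configurations, and these are ruled out by comparison
  with an explicit smaller container.
\<close>

text \<open>A minimal container is touched on every side by a vertex of the triangle. Hence, once a
  side of the triangle lies on the axis, each end of it that is not a container vertex forces the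
  third vertex onto the container side issuing from the nearer corner. The cases are the number of
  ends at container vertices, times the vertex at which the equal sides meet. The obstacle is that
  stationarity alone is not enough: when the equal sides meet on the axis, some stationary shapes
  survive and may even be local minima. If one end is at a container vertex, the competitor takes
  over the triangle's own angle at that end, between legs just long enough or as long as before. If
  neither is, only the isosceles right triangle survives, and it needs a competitor far away from it
  in shape.\<close>

section \<open>Local minima and persistence of strict inequalities\<close>

lemma local_min_deriv:
  fixes f :: "real \<Rightarrow> real"
  assumes "(f has_real_derivative l) (at x)" and "\<forall>\<^sub>F t in nhds x. f x \<le> f t"
  shows "l = 0"
proof -
  obtain d where "0 < d" "\<forall>t. dist t x < d \<longrightarrow> f x \<le> f t"
    using assms(2) unfolding eventually_nhds_metric by blast
  then show ?thesis
    using DERIV_local_min[OF assms(1), of d] by (auto simp: dist_real_def abs_minus_commute)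
qed

text \<open>Containment conditions that hold strictly persist for nearby parameters on both sides.
  This makes the members of a one-parameter family admissible competitors.\<close>

lemma eventually_less_nhds:
  fixes f g :: "real \<Rightarrow> real"
  assumes "isCont f x" "isCont g x" "f x < g x"
  shows "\<forall>\<^sub>F t in nhds x. f t < g t"
proof -
  have "((\<lambda>t. g t - f t) \<longlongrightarrow> g x - f x) (nhds x)"
    using assms(1,2) by (intro tendsto_diff) (simp_all add: isCont_def tendsto_at_iff_tendsto_nhds)
  from order_tendstoD(1)[OF this, of 0] assms(3) show ?thesis
    by (simp add: eventually_mono)
qed

section \<open>Containers with a side on the first axis\<close>

text \<open>Twice the signed area, positive for counterclockwise vertices: the coordinate form of
  \<open>orient\<close>. Separate real coordinates turn containment into polynomial
  inequalities.\<close>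

definition area2 :: "real \<Rightarrow> real \<Rightarrow> real \<Rightarrow> real \<Rightarrow> real \<Rightarrow> real \<Rightarrow> real" where
  "area2 p1 p2 q1 q2 r1 r2 = (q1 - p1) * (r2 - p2) - (r1 - p1) * (q2 - p2)"

definition inside :: "real \<Rightarrow> real \<Rightarrow> real \<Rightarrow> real \<Rightarrow> real \<Rightarrow> real \<Rightarrow> real \<Rightarrow> real \<Rightarrow> bool" where
  "inside p1 p2 q1 q2 r1 r2 u v \<longleftrightarrow>
     0 \<le> area2 p1 p2 q1 q2 u v \<and> 0 \<le> area2 q1 q2 r1 r2 u v \<and> 0 \<le> area2 r1 r2 p1 p2 u v"

text \<open>The triangle is \<open>(a, 0), (b, 0), (c, h)\<close> and the container \<open>(x, y), (0, 0), (z, 0)\<close>, whose doubled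
  area is \<open>z y\<close>. The first vertex of a competitor is its apex.\<close>

locale flush_position =
  fixes a b c h x y z :: real
  assumes y_pos: "0 < y" and z_pos: "0 < z" and h_pos: "0 < h"
    and a_nonneg: "0 \<le> a" and a_less_b: "a < b" and b_le_z: "b \<le> z"
    and left: "x * h \<le> c * y" and right: "(c - z) * y \<le> (x - z) * h"
    and touch_left: "0 < a \<Longrightarrow> c * y = x * h"
    and touch_right: "b < z \<Longrightarrow> (c - z) * y = (x - z) * h"
    and minimal: "\<And>p1 p2 q1 q2 r1 r2. (q1 - p1)^2 + (q2 - p2)^2 = (r1 - p1)^2 + (r2 - p2)^2 \<Longrightarrow>
      0 < area2 p1 p2 q1 q2 r1 r2 \<Longrightarrow> inside p1 p2 q1 q2 r1 r2 a 0 \<Longrightarrow>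
      inside p1 p2 q1 q2 r1 r2 b 0 \<Longrightarrow> inside p1 p2 q1 q2 r1 r2 c h \<Longrightarrow>
      z * y \<le> area2 p1 p2 q1 q2 r1 r2"
begin

text \<open>Mirroring in the perpendicular bisector of the axis side exchanges its two ends, so each
  exclusion proved for one end holds for the other. A mirror image reverses orientation, hence the
  exchange of \<open>q\<close> and \<open>r\<close> in the competitors.\<close>

lemma reflect: "flush_position (z - b) (z - a) (z - c) h (z - x) y z"
proof unfold_locales
  fix p1 p2 q1 q2 r1 r2
  assume eq: "(q1 - p1)^2 + (q2 - p2)^2 = (r1 - p1)^2 + (r2 - p2)^2"
    and pos: "0 < area2 p1 p2 q1 q2 r1 r2"
    and ins: "inside p1 p2 q1 q2 r1 r2 (z - b) 0" "inside p1 p2 q1 q2 r1 r2 (z - a) 0"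
      "inside p1 p2 q1 q2 r1 r2 (z - c) h"
  have refl: "area2 (z - s1) s2 (z - t1) t2 u v = area2 t1 t2 s1 s2 (z - u) v" for s1 s2 t1 t2 u v
    by (simp add: area2_def algebra_simps)
  have ins': "inside (z - p1) p2 (z - r1) r2 (z - q1) q2 u v = inside p1 p2 q1 q2 r1 r2 (z - u) v" for u v
    unfolding inside_def refl by auto
  have "z * y \<le> area2 (z - p1) p2 (z - r1) r2 (z - q1) q2"
    by (rule minimal) (use eq pos ins in \<open>simp_all add: ins' refl, simp_all add: area2_def power2_eq_square algebra_simps\<close>)
  then show "z * y \<le> area2 p1 p2 q1 q2 r1 r2"
    by (simp add: area2_def algebra_simps)
next
  show "(z - x) * h \<le> (z - c) * y" using right by (simp add: algebra_simps)
  show "(z - c - z) * y \<le> (z - x - z) * h" using left by (simp add: algebra_simps)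
  show "0 < z - b \<Longrightarrow> (z - c) * y = (z - x) * h" using touch_right by (simp add: algebra_simps)
  show "z - a < z \<Longrightarrow> (z - c - z) * y = (z - x - z) * h" using touch_left by (simp add: algebra_simps)
qed (use y_pos z_pos h_pos a_nonneg a_less_b b_le_z in auto)

section \<open>Neither end of the flush side at a container vertex\<close>

text \<open>Neither end of the flush side reaches the other two container sides, so the third vertex
  touches both of them, and they meet only at \<open>(x, y)\<close>.\<close>

lemma apex_eqI:
  assumes "0 < a" "b < z"
  shows "c = x" "h = y"
proof -
  have "z * h = z * y" using touch_left touch_right assms by (simp add: algebra_simps)
  then show "h = y" using z_pos by simp
  then show "c = x" using touch_left assms y_pos by simp
qed

text \<open>The base has slack at both ends: moving its endpoints inwards by the same amount keeps
  the legs equal and the height fixed.\<close>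

lemma not_interior_base:
  assumes "0 < a" "b < z" shows "2 * x \<noteq> z"
proof
  assume x: "2 * x = z"
  note C = apex_eqI[OF assms]
  define d where "d = min a (z - b)"
  have d: "0 < d" "d \<le> a" "d \<le> z - b" using assms by (auto simp: d_def)
  have "z * y \<le> area2 x y d 0 (z - d) 0"
  proof (rule minimal)
    show "(d - x)\<^sup>2 + (0 - y)\<^sup>2 = (z - d - x)\<^sup>2 + (0 - y)\<^sup>2"
      by (simp add: x[symmetric] power2_eq_square algebra_simps)
    have "2 * d < z" using d a_less_b by linarith
    then show "0 < area2 x y d 0 (z - d) 0"
      using y_pos by (simp add: area2_def algebra_simps mult_less_cancel_left_pos)
    show "inside x y d 0 (z - d) 0 a 0" "inside x y d 0 (z - d) 0 b 0" "inside x y d 0 (z - d) 0 c h"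
      using d a_less_b y_pos \<open>2 * d < z\<close> mult_right_mono[of "a + d" z y] mult_right_mono[of "b + d" z y]
      unfolding C by (simp_all add: inside_def area2_def algebra_simps)
  qed
  then have "d * y \<le> 0" by (simp add: area2_def algebra_simps)
  with d y_pos show False by (simp add: mult_le_0_iff)
qed

lemma not_interior_leg:
  assumes "0 < a" "b < z" shows "x^2 + y^2 \<noteq> z^2"
proof
  assume iso: "x^2 + y^2 = z^2"
  note C = apex_eqI[OF assms]
  \<comment> \<open>Sliding the apex along the axis can only be critical when the apex angle is right.\<close>
  define L where "L t = sqrt ((x - t)^2 + y^2)" for t
  have L0: "L 0 = z" using iso z_pos by (simp add: L_def)
  have Lpos: "0 < L t" for t using y_pos by (simp add: L_def add_nonneg_pos)
  have contL: "isCont L t" for t unfolding L_def by (intro continuous_intros)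
  have ev1: "\<forall>\<^sub>F t in nhds 0. t < a"
    by (rule eventually_less_nhds) (use assms in auto)
  have ev2: "\<forall>\<^sub>F t in nhds 0. b < t + L t"
    by (rule eventually_less_nhds) (use assms contL L0 in \<open>auto intro!: continuous_intros\<close>)
  have "\<forall>\<^sub>F t in nhds 0. L 0 * y \<le> L t * y"
    using ev1 ev2
  proof eventually_elim
    case (elim t)
    have "z * y \<le> area2 t 0 (t + L t) 0 x y"
    proof (rule minimal)
      show "(t + L t - t)\<^sup>2 + (0 - 0)\<^sup>2 = (x - t)\<^sup>2 + (y - 0)\<^sup>2" by (simp add: L_def)
      show "0 < area2 t 0 (t + L t) 0 x y" using Lpos y_pos by (simp add: area2_def)
      show "inside t 0 (t + L t) 0 x y a 0" "inside t 0 (t + L t) 0 x y b 0" "inside t 0 (t + L t) 0 x y c h"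
        using elim a_less_b y_pos Lpos[of t] mult_right_mono[of a "t + L t" y] mult_right_mono[of b "t + L t" y]
        unfolding C by (auto simp: inside_def area2_def algebra_simps)
    qed
    then show ?case by (simp add: L0 area2_def)
  qed
  moreover have "((\<lambda>t. L t * y) has_real_derivative (- x / z * y)) (at 0)"
    unfolding L_def using iso z_pos
    by (auto intro!: derivative_eq_intros simp: add_nonneg_pos y_pos field_simps)
  ultimately have "- x / z * y = 0" by (rule local_min_deriv[rotated])
  then have x: "x = 0" using z_pos y_pos by simp
  then have zy: "z = y" using iso y_pos z_pos by (simp add: power2_eq_iff)
  \<comment> \<open>The right angle is a true local minimum. It is beaten by the triangle with apex \<open>(a, 0)\<close> and one
    leg to \<open>(0, y)\<close> whose third vertex lies on the ray from \<open>(0, y)\<close> through \<open>(b, 0)\<close>, at \<open>k\<close> times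
    that distance.\<close>
  define k where "k = 2 * (a * b + y^2) / (b^2 + y^2)"
  have den: "0 < b^2 + y^2" using y_pos by (simp add: add_nonneg_pos)
  have keq: "k * (b^2 + y^2) = 2 * (a * b + y^2)" unfolding k_def using den by simp
  have b2: "b^2 < y^2" using assms a_less_b zy by (intro power_strict_mono) auto
  have "0 < a * b" using assms a_less_b by simp
  then have k1: "1 < k" unfolding k_def using den b2 by (simp add: less_divide_eq)
  have "z * y \<le> area2 a 0 (k * b) (y - k * y) 0 y"
  proof (rule minimal)
    have "k * (k * (b^2 + y^2) - 2 * (a * b + y^2)) = 0" using keq by simp
    then show "(k * b - a)\<^sup>2 + (y - k * y - 0)\<^sup>2 = (0 - a)\<^sup>2 + (y - 0)\<^sup>2"
      by (simp add: power2_eq_square algebra_simps)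
    have ar: "area2 a 0 (k * b) (y - k * y) 0 y = k * ((b - a) * y)" by (simp add: area2_def algebra_simps)
    have ar': "0 \<le> (k-1) * ((b - a) * y)" using k1 a_less_b y_pos by simp
    show "0 < area2 a 0 (k * b) (y - k * y) 0 y" using k1 a_less_b y_pos unfolding ar by simp
    show "inside a 0 (k * b) (y - k * y) 0 y a 0" "inside a 0 (k * b) (y - k * y) 0 y b 0"
      "inside a 0 (k * b) (y - k * y) 0 y c h"
      using ar' a_less_b y_pos k1 unfolding C x
      by (auto simp: inside_def area2_def algebra_simps)
  qed
  then have "y * y \<le> k * ((b - a) * y)" unfolding zy by (simp add: area2_def algebra_simps)
  then have "y \<le> k * (b - a)" using y_pos by (simp flip: mult.assoc)
  then have "y * (b^2 + y^2) \<le> (k * (b^2 + y^2)) * (b - a)"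
    using den by (simp add: mult.commute mult.left_commute)
  then have 1: "y * (b^2 + y^2) \<le> 2 * (a * b + y^2) * (b - a)" unfolding keq .
  \<comment> \<open>Beyond \<open>y^2 * b\<close>, the product below contributes
    \<open>a * (b^2 - y^2) - a^2 * b\<close>, which is negative because \<open>b < y\<close>. What
    remains contradicts \<open>0 \<le> (y - b)^2\<close>.\<close>
  have "a * b^2 < a * y^2" using b2 assms by simp
  moreover have "0 \<le> a^2 * b" using assms a_less_b by simp
  ultimately have "(a * b + y^2) * (b - a) < y^2 * b" by (simp add: power2_eq_square algebra_simps)
  with 1 have "y * (b^2 + y^2) < y * (2 * y * b)" by (simp add: power2_eq_square algebra_simps)
  then have "b^2 + y^2 < 2 * y * b" using y_pos by simp
  then have "(y - b)^2 < 0" by (simp add: power2_eq_square algebra_simps)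
  then show False by simp
qed


text \<open>The competitor has its apex at the common vertex \<open>a = 0\<close>, the angle of the triangle there, and legs \<open>m\<close>.\<close>

lemma apex_origin_bound:
  assumes "a = 0" and "b \<le> m" and m: "0 < m" "c^2 + h^2 \<le> m^2"
  shows "z * y * sqrt (c^2 + h^2) \<le> m^2 * h"
proof -
  define d where "d = sqrt (c^2 + h^2)"
  have d: "0 < d" "d^2 = c^2 + h^2" using h_pos by (simp_all add: d_def add_nonneg_pos)
  have "d \<le> m" using m d by (metis less_imp_le power2_le_imp_le)
  then have md: "1 \<le> m / d" using d by simp
  have "z * y \<le> area2 0 0 m 0 (m / d * c) (m / d * h)"
  proof (rule minimal)
    have "(m / d * c)\<^sup>2 + (m / d * h)\<^sup>2 = (m / d)^2 * d^2"
      unfolding d(2) power_mult_distrib by (rule distrib_left[symmetric])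
    also have "\<dots> = m^2" using d(1) by (simp add: power_divide)
    finally show "(m - 0)\<^sup>2 + (0 - 0)\<^sup>2 = (m / d * c - 0)\<^sup>2 + (m / d * h - 0)\<^sup>2" by simp
    show "0 < area2 0 0 m 0 (m / d * c) (m / d * h)"
      using m h_pos d by (simp add: area2_def)
    define k where "k = m / d"
    have k: "1 \<le> k" using md by (simp add: k_def)
    have 1: "0 \<le> (m - b) * (k * h)" "0 \<le> b * (k * h)" "0 \<le> (k - 1) * (m * h)"
      using k m h_pos assms a_less_b by simp_all
    show "inside 0 0 m 0 (m / d * c) (m / d * h) a 0" "inside 0 0 m 0 (m / d * c) (m / d * h) b 0"
      "inside 0 0 m 0 (m / d * c) (m / d * h) c h"
      using k m h_pos assms a_less_b 1 unfolding k_def[symmetric] by (auto simp: inside_def area2_def algebra_simps)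
  qed
  \<comment> \<open>Two legs of length \<open>m\<close> enclose an angle of sine
    \<open>h / d\<close>.\<close>
  also have "area2 0 0 m 0 (m / d * c) (m / d * h) = m^2 * h / d"
    by (simp add: area2_def power2_eq_square)
  finally show ?thesis using d by (simp add: pos_le_divide_eq flip: d_def)
qed

section \<open>Exactly one end of the flush side at a container vertex\<close>

context
  assumes a0: "a = 0" and b_less_z: "b < z" and strict_left: "x * h < c * y"
begin

lemma b_pos: "0 < b" using a0 a_less_b by simp

lemma third_side: "(c - z) * y = (x - z) * h" using touch_right b_less_z by simp

text \<open>The third vertex lies on the side from \<open>(x, y)\<close> to \<open>(z, 0)\<close>
  but off the left side, so it lies strictly below \<open>(x, y)\<close>.\<close>

lemma h_less_y: "h < y"
proof -
  have "z * h < z * y" using third_side strict_left by (simp add: algebra_simps)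
  then show ?thesis using z_pos by simp
qed

text \<open>Turning the right leg about \<open>(c, h)\<close>, with the left leg following
  symmetrically, is stationary only if the apex has height \<open>h\<close>, contrary to
  \<open>h_less_y\<close>.\<close>

lemma not_corner_base: "2 * x \<noteq> z"
proof
  assume x: "2 * x = z"
  then have xpos: "0 < x" using z_pos by simp
  \<comment> \<open>Vary the slope \<open>t\<close> of the legs, keeping the right leg through \<open>(c, h)\<close>; \<open>w t\<close> is half the base.\<close>
  define t0 where "t0 = y / x"
  define w where "w t = (c + h / t) / 2" for t
  have t0: "0 < t0" using xpos y_pos by (simp add: t0_def)
  have w0: "w t0 = x" unfolding w_def t0_def using third_side x y_pos by (auto simp: field_simps)
  have cont: "isCont w t0" unfolding w_def using t0 by (intro continuous_intros) auto
  have ev0: "\<forall>\<^sub>F t in nhds t0. 0 < t"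
    by (rule eventually_less_nhds) (use t0 in auto)
  have ev1: "\<forall>\<^sub>F t in nhds t0. b < 2 * w t"
    by (rule eventually_less_nhds) (use b_less_z x w0 cont in \<open>auto\<close>)
  have ev2: "\<forall>\<^sub>F t in nhds t0. h < c * t"
    by (rule eventually_less_nhds) (use strict_left xpos in \<open>auto simp: t0_def field_simps\<close>)
  define f where "f t = 2 * (t * (w t)^2)" for t
  have "\<forall>\<^sub>F t in nhds t0. f t0 \<le> f t"
    using ev0 ev1 ev2
  proof eventually_elim
    case (elim t)
    have wpos: "0 < w t" using elim b_pos by simp
    have wt: "2 * w t * t = c * t + h" using elim by (simp add: w_def field_simps)
    have "z * y \<le> area2 (w t) (t * w t) 0 0 (2 * w t) 0"
    proof (rule minimal)
      show "(0 - w t)\<^sup>2 + (0 - t * w t)\<^sup>2 = (2 * w t - w t)\<^sup>2 + (0 - t * w t)\<^sup>2" by simp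
      show "0 < area2 (w t) (t * w t) 0 0 (2 * w t) 0" using elim wpos by (simp add: area2_def)
      have 1: "0 \<le> (2 * w t - b) * (t * w t)" "0 \<le> b * (t * w t)" using elim wpos b_pos by simp_all
      show "inside (w t) (t * w t) 0 0 (2 * w t) 0 a 0" "inside (w t) (t * w t) 0 0 (2 * w t) 0 b 0"
        using elim wpos 1 by (auto simp: inside_def area2_def a0 algebra_simps)
      have 2: "0 \<le> (c * t - h) * w t" using elim wpos by simp
      have 3: "w t * (2 * w t * t) = w t * (c * t + h)" by (simp add: wt)
      show "inside (w t) (t * w t) 0 0 (2 * w t) 0 c h"
        using h_pos wpos 2 3 by (auto simp: inside_def area2_def algebra_simps)
    qed
    also have "\<dots> = f t" by (simp add: f_def area2_def power2_eq_square)
    also have "z * y = f t0" using xpos unfolding f_def w0 by (simp add: t0_def power2_eq_square flip: x)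
    finally show ?case .
  qed
  moreover have "(f has_real_derivative 2 * ((w t0)^2 - t0 * (w t0 * (h / t0^2)))) (at t0)"
  proof -
    have dw: "(w has_real_derivative - (h / t0^2) / 2) (at t0)"
      unfolding w_def using t0 by (auto intro!: derivative_eq_intros simp: power2_eq_square)
    show ?thesis
      unfolding f_def by (rule derivative_eq_intros refl dw)+ (simp add: algebra_simps)
  qed
  ultimately have "2 * ((w t0)^2 - t0 * (w t0 * (h / t0^2))) = 0" by (rule local_min_deriv[rotated])
  then have "x * t0 = h" using xpos t0 by (simp add: w0 power2_eq_square field_simps)
  then show False using h_less_y xpos by (simp add: t0_def)
qed

lemma not_corner_leg_origin: "x^2 + y^2 \<noteq> z^2"
proof
  assume iso: "x^2 + y^2 = z^2"
  have absx: "\<bar>x\<bar> < z"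
    using iso y_pos z_pos by (intro power2_less_imp_less[of "\<bar>x\<bar>" z]) (auto simp flip: iso)
  \<comment> \<open>Vary \<open>u\<close>, the tangent of half the apex angle, keeping the base through \<open>(c, h)\<close>; \<open>l u\<close> is the leg.\<close>
  define u0 where "u0 = y / (x + z)"
  have xz: "0 < x + z" "0 < z - x" using absx by auto
  have u0: "0 < u0" using xz y_pos by (simp add: u0_def)
  \<comment> \<open>The base is perpendicular to the bisector of the apex angle, which has direction
    \<open>(1, u)\<close>. The line through \<open>(c, h)\<close> with this normal meets the axis at
    \<open>c + h * u\<close>.\<close>
  define l where "l u = c + h * u" for u
  have yy: "y * y = (z - x) * (z + x)" using iso by (simp add: power2_eq_square algebra_simps)
  have "(z - x) * (h * y) = y * (y * (z - c))" using arg_cong[OF third_side, of "\<lambda>t. - y * t"] by (simp add: algebra_simps)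
  also have "\<dots> = (z - x) * ((z + x) * (z - c))" using yy by (metis mult.assoc)
  finally have "h * y = (z + x) * (z - c)" using xz by simp
  then have l0: "l u0 = z" unfolding l_def u0_def using xz by (simp add: field_simps)
  have den: "0 < 1 + u^2" for u :: real by (simp add: add_pos_nonneg)
  have "u0 * (x + z) = y" using xz by (simp add: u0_def)
  have "(u0 ^ 2 * (x + z)) * (x + z) = (u0 * (x + z)) * (u0 * (x + z))"
    by (simp add: power2_eq_square algebra_simps)
  also have "\<dots> = (z - x) * (x + z)" unfolding \<open>u0 * (x + z) = y\<close> yy by simp
  finally have u0sq: "u0 ^ 2 * (x + z) = z - x" using xz by simp
  \<comment> \<open>\<open>x0\<close> and \<open>y0\<close> are the half-angle formulas for the
    cosine \<open>x / z\<close> and the sine \<open>y / z\<close> of the apex angle.\<close>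
  then have x0: "x * (1 + u0^2) = z * (1 - u0^2)" by (simp add: algebra_simps)
  have "(x + z) * (y * (1 + u0^2)) = y * ((x + z) + u0^2 * (x + z))" by (simp add: algebra_simps)
  also have "\<dots> = y * (2 * z)" unfolding u0sq by simp
  also have "\<dots> = (x + z) * (2 * u0 * z)" unfolding \<open>u0 * (x + z) = y\<close>[symmetric] by (simp add: algebra_simps)
  finally have y0: "y * (1 + u0^2) = z * (2 * u0)" using xz by simp
  define f where "f u = (l u)^2 * (2 * u) / (1 + u^2)" for u
  have "z^2 * (2 * u0) = z * y * (1 + u0^2)" using y0 by (simp add: power2_eq_square)
  then have f0: "f u0 = z * y" unfolding f_def l0 using den[of u0] by simp
  have ev0: "\<forall>\<^sub>F u in nhds u0. 0 < u"
    by (rule eventually_less_nhds) (use u0 in auto)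
  have ev1: "\<forall>\<^sub>F u in nhds u0. b < l u"
    unfolding l_def by (rule eventually_less_nhds) (use b_less_z l0 in \<open>auto simp: l_def\<close>)
  have "(1 + u0^2) * (x * h) < (1 + u0^2) * (c * y)" using strict_left den[of u0] by simp
  then have "h * (x * (1 + u0^2)) < c * (y * (1 + u0^2))" by (simp add: algebra_simps)
  then have "z * (h * (1 - u0^2)) < z * (c * (2 * u0))" unfolding x0 y0 by (simp add: algebra_simps)
  then have inside0: "h * (1 - u0^2) < c * (2 * u0)" using z_pos by simp
  have ev2: "\<forall>\<^sub>F u in nhds u0. h * (1 - u^2) < c * (2 * u)"
    by (rule eventually_less_nhds) (use inside0 in auto)
  have "\<forall>\<^sub>F u in nhds u0. f u0 \<le> f u"
    using ev0 ev1 ev2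
  proof eventually_elim
    case (elim u)
    \<comment> \<open>By the half-angle formulas, \<open>(s * (1 - u^2), s * (2 * u))\<close> is the
      end of the second leg of length \<open>l u\<close>.\<close>
    define s where "s = l u / (1 + u^2)"
    have lpos: "0 < l u" using elim b_pos by simp
    have spos: "0 < s" using lpos den by (simp add: s_def)
    have lu: "l u = s * (1 + u^2)" using den[of u] by (simp add: s_def)
    have ceq: "c = s * (1 + u^2) - h * u" using lu by (simp add: l_def)
    have "z * y \<le> area2 0 0 (l u) 0 (s * (1 - u^2)) (s * (2 * u))"
    proof (rule minimal)
      show "(l u - 0)\<^sup>2 + (0 - 0)\<^sup>2 = (s * (1 - u\<^sup>2) - 0)\<^sup>2 + (s * (2 * u) - 0)\<^sup>2"
        unfolding lu by (simp add: power2_eq_square algebra_simps)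
      show "0 < area2 0 0 (l u) 0 (s * (1 - u^2)) (s * (2 * u))"
        using elim lpos spos by (simp add: area2_def)
      have 1: "0 \<le> (l u - b) * (s * (2 * u))" "0 \<le> b * (s * (2 * u))" using elim spos b_pos by simp_all
      show "inside 0 0 (l u) 0 (s * (1 - u^2)) (s * (2 * u)) a 0"
        "inside 0 0 (l u) 0 (s * (1 - u^2)) (s * (2 * u)) b 0"
        using elim lpos spos 1 by (auto simp: inside_def area2_def a0 algebra_simps)
      have 2: "0 \<le> s * (c * (2 * u) - h * (1 - u^2))" using elim spos by simp
      have 3: "area2 (l u) 0 (s * (1 - u^2)) (s * (2 * u)) c h = 0"
        unfolding area2_def lu ceq by (simp add: power2_eq_square algebra_simps)
      show "inside 0 0 (l u) 0 (s * (1 - u^2)) (s * (2 * u)) c h"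
        unfolding inside_def 3 using h_pos lpos 2 by (auto simp: area2_def algebra_simps)
    qed
    also have "\<dots> = f u" by (simp add: area2_def f_def s_def power2_eq_square)
    finally show ?case using f0 by simp
  qed
  moreover have "(f has_real_derivative
      2 * l u0 * (h * u0 * (3 + u0^2) + c * (1 - u0^2)) / (1 + u0^2)^2) (at u0)"
  proof -
    have dl: "(l has_real_derivative h) (at u0)"
      unfolding l_def by (auto intro!: derivative_eq_intros)
    have "(f has_real_derivative ((2 * l u0 * h * (2 * u0) + (l u0)^2 * 2) * (1 + u0^2)
        - (l u0)^2 * (2 * u0) * (2 * u0)) / ((1 + u0^2) * (1 + u0^2))) (at u0)"
      unfolding f_def by (rule derivative_eq_intros refl dl)+ (use den[of u0] in auto)
    moreover have "(2 * l u0 * h * (2 * u0) + (l u0)^2 * 2) * (1 + u0^2) - (l u0)^2 * (2 * u0) * (2 * u0)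
        = 2 * l u0 * (h * u0 * (3 + u0^2) + c * (1 - u0^2))"
      unfolding l_def by algebra
    ultimately show ?thesis by (simp add: power2_eq_square)
  qed
  ultimately have "2 * l u0 * (h * u0 * (3 + u0^2) + c * (1 - u0^2)) / (1 + u0^2)^2 = 0"
    by (rule local_min_deriv[rotated])
  then have "h * u0 * (3 + u0^2) + c * (1 - u0^2) = 0"
    using z_pos den[of u0] by (simp add: l0)
  then have crit: "h * u0 * (3 + u0^2) = c * (u0^2 - 1)" by (simp add: algebra_simps)
  \<comment> \<open>A critical point has an obtuse apex angle whose sine exceeds that of the angle of the triangle
    at the origin, so the container of \<open>apex_origin_bound\<close> is smaller.\<close>
  have "0 < c * (u0^2 - 1)" using crit[symmetric] h_pos u0 by (simp add: add_pos_nonneg)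
  have u1: "1 < u0^2"
  proof (rule ccontr)
    assume n: "\<not> 1 < u0^2"
    then have "c < 0" using \<open>0 < c * (u0^2 - 1)\<close> by (simp add: zero_less_mult_iff)
    then have "c * (2 * u0) < 0" using u0 by (simp add: mult_neg_pos)
    moreover have "0 \<le> h * (1 - u0^2)" using n h_pos by simp
    ultimately show False using inside0 by simp
  qed
  then have cpos: "0 < c" using \<open>0 < c * (u0^2 - 1)\<close> by (simp add: zero_less_mult_iff)
  have xneg: "x < 0" using x0 u1 den[of u0] z_pos
    by (smt (verit) mult_nonneg_nonneg mult_pos_neg)
  \<comment> \<open>A comparison of tangents: \<open>h / c\<close> belongs to the triangle's angle
    at the origin, and \<open>2 * u0 / (u0^2 - 1)\<close> to the supplement of the obtuse apex
    angle. Both angles are acute, so their sines compare in the same way.\<close>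
  have "h * (u0^2 - 1) < c * (2 * u0)"
  proof -
    have "(h * (u0^2 - 1)) * (u0 * (3 + u0^2)) = (u0^2 - 1) * (h * u0 * (3 + u0^2))"
      by (simp only: mult.assoc mult.commute mult.left_commute)
    also have "\<dots> = c * (u0^2 - 1)^2" unfolding crit by (simp add: power2_eq_square)
    also have "\<dots> < c * (2 * u0 ^2 * (3 + u0^2))"
    proof -
      have "(u0^2 - 1)^2 = u0^2 * u0^2 - 2 * u0^2 + 1" by (simp add: power2_eq_square algebra_simps)
      moreover have "0 < u0^2 * u0^2" using u0 by simp
      moreover have "2 * u0^2 * (3 + u0^2) = 6 * u0^2 + 2 * (u0^2 * u0^2)" by (simp add: algebra_simps)
      ultimately have "(u0^2 - 1)^2 < 2 * u0 ^2 * (3 + u0^2)" using u1 by linarith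
      then show ?thesis using cpos by simp
    qed
    also have "\<dots> = (c * (2 * u0)) * (u0 * (3 + u0^2))" by (simp add: power2_eq_square algebra_simps)
    finally show ?thesis using u0 den[of u0] by (simp add: mult_less_cancel_right add_pos_nonneg)
  qed
  then have "z * (h * (u0^2 - 1)) < z * (c * (2 * u0))" using z_pos by simp
  then have "h * (z * (u0^2 - 1)) < c * (z * (2 * u0))" by (simp add: algebra_simps)
  moreover have "z * (u0^2 - 1) = (1 + u0^2) * - x" using x0 by (simp add: algebra_simps)
  ultimately have "(1 + u0^2) * (h * - x) < (1 + u0^2) * (c * y)"
    unfolding y0[symmetric] by (simp only: mult.assoc mult.commute mult.left_commute)
  then have hx: "h * - x < c * y" by (rule mult_left_less_imp_less) (use den[of u0] in simp)
  have "(h * -x)^2 < (c * y)^2" using hx h_pos xneg by (intro power_strict_mono) (auto intro: mult_nonneg_nonpos)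
  then have sine: "h^2 * z^2 < y^2 * (c^2 + h^2)"
    unfolding iso[symmetric] by (simp add: power2_eq_square algebra_simps)
  \<comment> \<open>The point \<open>(c, h)\<close> lies on the base, a chord of the circle of
    radius \<open>z\<close> about the apex. This makes \<open>m = z\<close> admissible in
    \<open>apex_origin_bound\<close>.\<close>
  have dz: "c^2 + h^2 \<le> z^2"
  proof -
    have "h * (1 + u0^2) \<le> y * (1 + u0^2)" using h_less_y den[of u0] by simp
    then have "h * (h * (1 + u0^2)) \<le> h * (z * (2 * u0))" unfolding y0 using h_pos by simp
    moreover have c: "c = z - h * u0" using l0 by (simp add: l_def)
    ultimately show ?thesis unfolding c by (simp add: power2_eq_square algebra_simps)
  qed
  have "z * y * sqrt (c^2 + h^2) \<le> z^2 * h"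
    by (rule apex_origin_bound) (use a0 b_less_z z_pos dz in auto)
  then have "y * sqrt (c^2 + h^2) \<le> z * h" using z_pos by (simp add: power2_eq_square)
  then have "(y * sqrt (c^2 + h^2))^2 \<le> (z * h)^2" using y_pos by (intro power_mono) auto
  then show False using sine by (simp add: power_mult_distrib algebra_simps)
qed

text \<open>At a stationary position \<open>(c, h)\<close> is at least as far from the origin as
  from the apex \<open>(z, 0)\<close>, so the triangle's angle at the origin has a sine no larger
  than the apex angle. Legs shorter than \<open>z\<close> suffice for that angle, which gives a
  smaller container.\<close>

lemma not_corner_leg_far: "(x - z)^2 + y^2 \<noteq> z^2"
proof
  assume iso: "(x - z)^2 + y^2 = z^2"
  \<comment> \<open>Vary the apex \<open>(t, 0)\<close>, keeping one leg through \<open>(c, h)\<close>, at distance \<open>r t\<close> from the apex.\<close>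
  define r where "r t = sqrt ((t - c)^2 + h^2)" for t
  have rpos: "0 < r t" for t using h_pos by (simp add: r_def add_nonneg_pos)
  have rsq: "(r t)^2 = (t - c)^2 + h^2" for t by (simp add: r_def)
  have contr: "isCont r t" for t unfolding r_def by (intro continuous_intros)
  \<comment> \<open>Similar triangles along the leg: heights are proportional to the distances
    \<open>r z\<close> and \<open>z\<close> from \<open>(z, 0)\<close>.\<close>
  have rh: "r z * y = z * h"
  proof (rule power2_eq_imp_eq)
    have "(r z * y)^2 = ((c - z) * y)^2 + (h * y)^2"
      unfolding power_mult_distrib rsq by (simp add: power2_commute algebra_simps)
    also have "\<dots> = h^2 * ((x - z)^2 + y^2)" unfolding third_side power_mult_distrib by (simp add: distrib_left mult.commute)
    also have "\<dots> = (z * h)^2" unfolding iso by (simp add: power_mult_distrib)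
    finally show "(r z * y)^2 = (z * h)^2" .
  qed (use rpos[of z] y_pos z_pos h_pos in auto)
  have rz: "r z < z"
  proof -
    have "r z * y < z * y" unfolding rh using h_less_y z_pos by simp
    then show ?thesis using y_pos by simp
  qed
  have ev1: "\<forall>\<^sub>F t in nhds z. b < t"
    by (rule eventually_less_nhds) (use b_less_z in auto)
  have ev2: "\<forall>\<^sub>F t in nhds z. r t < t"
    by (rule eventually_less_nhds) (use rz contr in auto)
  \<comment> \<open>Legs of length \<open>t\<close> enclose an angle of sine \<open>h / r t\<close>,
    so this is the doubled area.\<close>
  define f where "f t = t^2 * h / r t" for t
  have f0: "f z = z * y" using rpos[of z] rh by (simp add: f_def field_simps power2_eq_square)
  have "\<forall>\<^sub>F t in nhds z. f z \<le> f t"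
    using ev1 ev2
  proof eventually_elim
    case (elim t)
    define k where "k = t / r t"
    have tpos: "0 < t" using elim b_pos by simp
    have k: "1 < k" using elim rpos[of t] by (simp add: k_def)
    have "z * y \<le> area2 t 0 (t - k * (t - c)) (k * h) 0 0"
    proof (rule minimal)
      have "k^2 * ((t - c)^2 + h^2) = t^2"
        unfolding rsq[symmetric] k_def using rpos[of t] by (simp add: power_divide)
      then show "(t - k * (t - c) - t)\<^sup>2 + (k * h - 0)\<^sup>2 = (0 - t)\<^sup>2 + (0 - 0)\<^sup>2"
        by (simp add: power_mult_distrib distrib_left)
      have ar: "area2 t 0 (t - k * (t - c)) (k * h) 0 0 = k * h * t" by (simp add: area2_def algebra_simps)
      show "0 < area2 t 0 (t - k * (t - c)) (k * h) 0 0" unfolding ar using k h_pos tpos by simp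
      have 1: "0 \<le> (t - b) * (k * h)" "0 \<le> b * (k * h)" "0 \<le> (k - 1) * (t * h)"
        using elim k h_pos b_pos tpos by simp_all
      show "inside t 0 (t - k * (t - c)) (k * h) 0 0 a 0" "inside t 0 (t - k * (t - c)) (k * h) 0 0 b 0"
        "inside t 0 (t - k * (t - c)) (k * h) 0 0 c h"
        using 1 k h_pos tpos by (auto simp: inside_def area2_def a0 algebra_simps)
    qed
    also have "\<dots> = f t" by (simp add: area2_def f_def k_def power2_eq_square algebra_simps)
    finally show ?case using f0 by simp
  qed
  moreover have "(f has_real_derivative h * z * (2 * (r z)^2 - z * (z - c)) / (r z)^3) (at z)"
  proof -
    have "0 < (z - c)^2 + h^2" using h_pos by (simp add: add_nonneg_pos)
    then have dr: "(r has_real_derivative (z - c) / r z) (at z)"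
      unfolding r_def by (auto intro!: derivative_eq_intros simp: divide_simps)
    have "(f has_real_derivative (2 * z * h * r z - z^2 * h * ((z - c) / r z)) / (r z * r z)) (at z)"
      unfolding f_def by (rule derivative_eq_intros refl dr)+ (use rpos[of z] in auto)
    moreover have "(2 * z * h * r z - z^2 * h * ((z - c) / r z)) * r z = h * z * (2 * (r z)^2 - z * (z - c))"
      using rpos[of z] by (simp add: left_diff_distrib) (simp add: power2_eq_square algebra_simps)
    then have "(2 * z * h * r z - z^2 * h * ((z - c) / r z)) / (r z * r z)
        = h * z * (2 * (r z)^2 - z * (z - c)) / (r z)^3"
      using rpos[of z] by (simp add: power3_eq_cube frac_eq_eq)
    ultimately show ?thesis by simp
  qed
  ultimately have "h * z * (2 * (r z)^2 - z * (z - c)) / (r z)^3 = 0" by (rule local_min_deriv[rotated])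
  then have crit: "2 * (r z)^2 = z * (z - c)" using h_pos z_pos rpos[of z] by simp
  have d2: "c^2 + h^2 = z^2 - 3 * (r z)^2"
    using crit rsq[of z] by (simp add: power2_eq_square algebra_simps)
  have "z - c \<le> r z" unfolding r_def by (rule real_le_rsqrt) simp
  then have "2 * (r z)^2 \<le> z * r z" unfolding crit using z_pos by simp
  then have r2: "2 * r z \<le> z" using rpos[of z] by (simp add: power2_eq_square)
  have "(2 * r z)^2 \<le> z^2" using r2 rpos[of z] by (intro power_mono) auto
  then have "(r z)^2 \<le> c^2 + h^2" unfolding d2 by simp
  then have "r z \<le> sqrt (c^2 + h^2)" by (rule real_le_rsqrt)
  \<comment> \<open>The shortest legs from the origin that reach past both \<open>(b, 0)\<close> and
    \<open>(c, h)\<close>.\<close>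
  define m where "m = max b (sqrt (c^2 + h^2))"
  have dz: "sqrt (c^2 + h^2) < z" using d2 rpos[of z] z_pos by (intro real_less_lsqrt) auto
  have m: "0 < m" "m < z" "b \<le> m" using dz b_less_z b_pos by (auto simp: m_def)
  have "c^2 + h^2 = (sqrt (c^2 + h^2))^2" by simp
  also have "\<dots> \<le> m^2" by (intro power_mono) (auto simp: m_def)
  finally have "z * y * sqrt (c^2 + h^2) \<le> m^2 * h" by (intro apex_origin_bound a0 m)
  also have "\<dots> < z^2 * h" using m h_pos by (simp add: power_strict_mono)
  also have "\<dots> = z * y * r z" using rh by (simp add: power2_eq_square algebra_simps)
  finally have "sqrt (c^2 + h^2) < r z" using z_pos y_pos by simp
  then show False using \<open>r z \<le> _\<close> by simp
qed

end

section \<open>Flush side equal to a container side\<close>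

context
  assumes a0: "a = 0" and bz: "b = z" and strict_left: "x * h < c * y"
    and strict_right: "(c - z) * y < (x - z) * h"
begin

text \<open>The third vertex is off both legs, so the apex can be lowered over the fixed base, and
  the area is linear in the height.\<close>

lemma not_common_base: "2 * x \<noteq> z"
proof
  assume x: "2 * x = z"
  have ev0: "\<forall>\<^sub>F t in nhds y. 0 < t"
    by (rule eventually_less_nhds) (use y_pos in auto)
  have ev1: "\<forall>\<^sub>F t in nhds y. x * h < c * t"
    by (rule eventually_less_nhds) (use strict_left in auto)
  have ev2: "\<forall>\<^sub>F t in nhds y. (c - z) * t < (x - z) * h"
    by (rule eventually_less_nhds) (use strict_right in auto)
  have "\<forall>\<^sub>F t in nhds y. z * y \<le> z * t"
    using ev0 ev1 ev2
  proof eventually_elim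
    case (elim t)
    have "z * y \<le> area2 x t 0 0 z 0"
    proof (rule minimal)
      show "(0 - x)\<^sup>2 + (0 - t)\<^sup>2 = (z - x)\<^sup>2 + (0 - t)\<^sup>2"
        by (simp add: x[symmetric])
      show "0 < area2 x t 0 0 z 0" using elim mult_pos_pos[OF z_pos, of t] by (simp add: area2_def algebra_simps)
      show "inside x t 0 0 z 0 a 0" "inside x t 0 0 z 0 b 0" "inside x t 0 0 z 0 c h"
        using elim z_pos h_pos a0 bz by (auto simp: inside_def area2_def algebra_simps)
    qed
    then show ?case by (simp add: area2_def algebra_simps)
  qed
  moreover have "((\<lambda>t. z * t) has_real_derivative z) (at y)"
    by (auto intro!: derivative_eq_intros)
  ultimately have "z = 0" by (rule local_min_deriv[rotated])
  then show False using z_pos by simp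
qed

lemma not_common_leg: "x^2 + y^2 \<noteq> z^2"
proof
  assume iso: "x^2 + y^2 = z^2"
  define X where "X s = x * cos s - y * sin s" for s
  define Y where "Y s = x * sin s + y * cos s" for s
  have 0: "X 0 = x" "Y 0 = y" by (simp_all add: X_def Y_def)
  have cont: "isCont X 0" "isCont Y 0" unfolding X_def Y_def by (auto intro!: continuous_intros)
  have ev0: "\<forall>\<^sub>F s in nhds 0. 0 < Y s"
    by (rule eventually_less_nhds) (use y_pos cont 0 in auto)
  have ev1: "\<forall>\<^sub>F s in nhds 0. X s * h < c * Y s"
    by (rule eventually_less_nhds) (use strict_left cont 0 in auto)
  have ev2: "\<forall>\<^sub>F s in nhds 0. (c - z) * Y s < (X s - z) * h"
    by (rule eventually_less_nhds) (use strict_right cont 0 in auto)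
  have "\<forall>\<^sub>F s in nhds 0. z * y \<le> z * Y s"
    using ev0 ev1 ev2
  proof eventually_elim
    case (elim s)
    have "z * y \<le> area2 0 0 z 0 (X s) (Y s)"
    proof (rule minimal)
      have "(X s)^2 + (Y s)^2 = (x^2 + y^2) * ((sin s)^2 + (cos s)^2)"
        unfolding X_def Y_def by algebra
      then show "(z - 0)\<^sup>2 + (0 - 0)\<^sup>2 = (X s - 0)\<^sup>2 + (Y s - 0)\<^sup>2" by (simp add: iso)
      show "0 < area2 0 0 z 0 (X s) (Y s)" using elim z_pos by (simp add: area2_def)
      show "inside 0 0 z 0 (X s) (Y s) a 0" "inside 0 0 z 0 (X s) (Y s) b 0" "inside 0 0 z 0 (X s) (Y s) c h"
        using elim z_pos h_pos a0 bz by (auto simp: inside_def area2_def algebra_simps)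
    qed
    then show ?case by (simp add: area2_def)
  qed
  then obtain e where e: "0 < e" "\<And>s. \<bar>s\<bar> < e \<Longrightarrow> y \<le> Y s"
    unfolding eventually_nhds_metric using z_pos by (auto simp: dist_real_def)
  define s where "s = min (e / 2) 1"
  have s: "0 < s" "s < e" "s \<le> 1" using e by (auto simp: s_def min_def)
  \<comment> \<open>The derivative gives nothing at a right apex angle. Averaging both senses of
    rotation replaces \<open>y\<close> by \<open>y * cos s\<close>, so at least one of them lowers
    the vertex.\<close>
  have "y + y \<le> Y s + Y (- s)" using e(2)[of s] e(2)[of "- s"] s by auto
  then have "y * 1 \<le> y * cos s" by (simp add: Y_def)
  then have "1 \<le> cos s" using y_pos by (simp only: mult_le_cancel_left_pos)
  moreover have "cos s < cos 0" using s pi_gt3 by (intro cos_monotone_0_pi) auto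
  ultimately show False by simp
qed

end

text \<open>The hypothesis lists the possible vertices between equal sides. In the conclusion the
  shared side is either the flush one, with a second ray agreeing at one of its ends, or a side
  ending at \<open>(x, y)\<close>; in the latter case the axis is the common second ray.\<close>

lemma shares_side_and_angle:
  assumes "2 * x = z \<or> x^2 + y^2 = z^2 \<or> (x - z)^2 + y^2 = z^2"
  shows "(a = 0 \<and> b = z \<and> (c * y = x * h \<or> (c - z) * y = (x - z) * h)) \<or>
    (a = 0 \<and> c = x \<and> h = y) \<or> (b = z \<and> c = x \<and> h = y)"
proof -
  interpret R: flush_position "z - b" "z - a" "z - c" h "z - x" y z by (rule reflect)
  have eqs: "2 * (z - x) = z \<longleftrightarrow> 2 * x = z" "(z - x)^2 = (x - z)^2" "(z - x - z)^2 = x^2"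
    by (auto simp: power2_commute)
  have sides: "(z - x) * h < (z - c) * y \<longleftrightarrow> (c - z) * y < (x - z) * h"
    "(z - c - z) * y < (z - x - z) * h \<longleftrightarrow> x * h < c * y"
    by (simp_all add: algebra_simps)
  have n1: "a = 0 \<or> b = z"
    using not_interior_base not_interior_leg R.not_interior_leg assms a_nonneg b_le_z
    unfolding eqs by fastforce
  have corner: "c = x \<and> h = y" if "c * y = x * h" "(c - z) * y = (x - z) * h"
  proof -
    have "z * h = z * y" using that by (simp add: algebra_simps)
    then show ?thesis using z_pos y_pos that by auto
  qed
  show ?thesis
  proof (cases "a = 0")
    case a0: True
    show ?thesis
    proof (cases "b = z")
      case True
      then have "\<not> (x * h < c * y \<and> (c - z) * y < (x - z) * h)"
        using a0 assms not_common_base not_common_leg R.not_common_leg unfolding eqs sides by auto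
      then show ?thesis using a0 True left right by (auto simp: not_less)
    next
      case False
      then have bz: "b < z" using b_le_z by simp
      then have "\<not> x * h < c * y"
        using a0 assms not_corner_base not_corner_leg_origin not_corner_leg_far by blast
      then have "c * y = x * h" using left by simp
      then show ?thesis using a0 corner touch_right[OF bz] by simp
    qed
  next
    case False
    then have b: "b = z" and a: "0 < a" using n1 a_nonneg by auto
    then have "\<not> (c - z) * y < (x - z) * h"
      using assms R.not_corner_base R.not_corner_leg_origin R.not_corner_leg_far
      unfolding eqs sides by auto
    then have "(c - z) * y = (x - z) * h" using right by simp
    then show ?thesis using b corner touch_left[OF a] by simp
  qed
qed

end

section \<open>Orientation and triangles in the plane\<close>

definition cross2 :: "real^2 \<Rightarrow> real^2 \<Rightarrow> real" where
  "cross2 u v = u $ 1 * v $ 2 - u $ 2 * v $ 1"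

definition orient :: "real^2 \<Rightarrow> real^2 \<Rightarrow> real^2 \<Rightarrow> real" where
  "orient P Q R = cross2 (Q - P) (R - P)"

text \<open>The symmetric form leaves the apex unspecified, so vertices may be permuted to put any
  chosen side on the axis.\<close>

definition isosceles :: "real^2 \<Rightarrow> real^2 \<Rightarrow> real^2 \<Rightarrow> bool" where
  "isosceles P Q R \<longleftrightarrow> dist P Q = dist P R \<or> dist Q R = dist Q P \<or> dist R P = dist R Q"

lemma cross2_linear:
  "cross2 (u + v) w = cross2 u w + cross2 v w" "cross2 w (u + v) = cross2 w u + cross2 w v"
  "cross2 (u - v) w = cross2 u w - cross2 v w" "cross2 w (u - v) = cross2 w u - cross2 w v"
  "cross2 (- u) w = - cross2 u w" "cross2 w (- u) = - cross2 w u"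
  "cross2 (k *\<^sub>R u) w = k * cross2 u w" "cross2 w (k *\<^sub>R u) = k * cross2 w u"
  by (simp_all add: cross2_def algebra_simps)

lemma orient_rotate: "orient Q R P = orient P Q R"
  by (simp add: orient_def cross2_def algebra_simps)

lemma orient_swap: "orient P R Q = - orient P Q R"
  by (simp add: orient_def cross2_def algebra_simps)

lemma orient_sum: "orient Y Z P + orient Z X P + orient X Y P = orient X Y Z"
  by (simp add: orient_def cross2_def algebra_simps)

lemma measure_eq_orient: "measure lborel (convex hull {A, B, C}) = \<bar>orient A B C\<bar> / 2"
  unfolding content_triangle orient_def cross2_def by (simp add: algebra_simps abs_minus_commute)

lemma collinear_iff_orient: "collinear {A, B, C} \<longleftrightarrow> orient A B C = 0"
proof -
  have "collinear {0, u, v} \<longleftrightarrow> cross2 u v = 0" for u v :: "real^2"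
  proof
    assume "collinear {0, u, v}"
    then show "cross2 u v = 0" by (auto simp: collinear_lemma cross2_def)
  next
    assume *: "cross2 u v = 0"
    show "collinear {0, u, v}"
    proof (cases "u $ 1 = 0")
      case False
      then have "v = (v $ 1 / u $ 1) *\<^sub>R u"
        using * by (simp add: vec_eq_iff forall_2 cross2_def field_simps)
      then show ?thesis unfolding collinear_lemma by blast
    next
      case True
      show ?thesis
      proof (cases "u $ 2 = 0")
        case True
        then have "u = 0" using \<open>u $ 1 = 0\<close> by (simp add: vec_eq_iff forall_2)
        then show ?thesis by (simp add: collinear_lemma)
      next
        case False
        then have "v = (v $ 2 / u $ 2) *\<^sub>R u"
          using * True by (simp add: vec_eq_iff forall_2 cross2_def field_simps)
        then show ?thesis unfolding collinear_lemma by blast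
      qed
    qed
  qed
  from this[of "B - A" "C - A"] have "collinear {0, B - A, C - A} \<longleftrightarrow> orient A B C = 0"
    by (simp add: orient_def)
  then show ?thesis using collinear_3[of B A C] by (simp add: insert_commute)
qed

text \<open>Divided by \<open>orient X Y Z\<close>, the three orientations are the barycentric
  coordinates of \<open>P\<close>.\<close>

lemma mem_hull_iff_orient:
  assumes "0 < orient X Y Z"
  shows "P \<in> convex hull {X, Y, Z} \<longleftrightarrow> 0 \<le> orient Y Z P \<and> 0 \<le> orient Z X P \<and> 0 \<le> orient X Y P"
proof
  assume "P \<in> convex hull {X, Y, Z}"
  then obtain u v w where uvw: "0 \<le> u" "0 \<le> v" "0 \<le> w" "u + v + w = 1"
    and P: "P = u *\<^sub>R X + v *\<^sub>R Y + w *\<^sub>R Z"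
    unfolding convex_hull_3 by blast
  have u: "u = 1 - v - w" using uvw by simp
  have "orient Y Z P = u * orient X Y Z" "orient Z X P = v * orient X Y Z" "orient X Y P = w * orient X Y Z"
    unfolding P u orient_def cross2_def by (simp_all add: algebra_simps)
  then show "0 \<le> orient Y Z P \<and> 0 \<le> orient Z X P \<and> 0 \<le> orient X Y P"
    using uvw assms by simp
next
  assume *: "0 \<le> orient Y Z P \<and> 0 \<le> orient Z X P \<and> 0 \<le> orient X Y P"
  define D where "D = orient X Y Z"
  have "D *\<^sub>R P = orient Y Z P *\<^sub>R X + orient Z X P *\<^sub>R Y + orient X Y P *\<^sub>R Z"
    by (simp add: D_def vec_eq_iff forall_2 orient_def cross2_def algebra_simps)
  then have "(1 / D) *\<^sub>R (D *\<^sub>R P) =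
      (1 / D) *\<^sub>R (orient Y Z P *\<^sub>R X + orient Z X P *\<^sub>R Y + orient X Y P *\<^sub>R Z)"
    by (rule arg_cong)
  then have "P = (orient Y Z P / D) *\<^sub>R X + (orient Z X P / D) *\<^sub>R Y + (orient X Y P / D) *\<^sub>R Z"
    using assms by (simp add: D_def scaleR_add_right)
  moreover have "orient Y Z P / D + orient Z X P / D + orient X Y P / D = 1"
    using orient_sum[of Y Z P X] assms by (simp add: D_def flip: add_divide_distrib)
  ultimately show "P \<in> convex hull {X, Y, Z}"
    unfolding convex_hull_3 using * assms D_def
    by (smt (verit, best) divide_nonneg_pos mem_Collect_eq)
qed

section \<open>Similarities of the plane\<close>

text \<open>Cramer's rule; it provides the translation that puts two sides of a turned triangle on
  prescribed lines.\<close>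

lemma cross2_solve:
  assumes "cross2 e f \<noteq> 0"
  obtains t where "cross2 e t = p" "cross2 f t = q"
proof
  have "cross2 e e = 0" "cross2 f f = 0" "cross2 f e = - cross2 e f" by (simp_all add: cross2_def)
  then show "cross2 e ((p / cross2 e f) *\<^sub>R f - (q / cross2 e f) *\<^sub>R e) = p"
    "cross2 f ((p / cross2 e f) *\<^sub>R f - (q / cross2 e f) *\<^sub>R e) = q"
    using assms by (simp_all add: cross2_linear)
qed

text \<open>Multiplication by \<open>1 - \<epsilon>\<i>\<close> when the plane is identified with the complex numbers.\<close>

definition twist :: "real \<Rightarrow> real^2 \<Rightarrow> real^2" where
  "twist \<epsilon> v = vector [v $ 1 + \<epsilon> * v $ 2, v $ 2 - \<epsilon> * v $ 1]"

lemma twist_linear: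
  "twist \<epsilon> (u + v) = twist \<epsilon> u + twist \<epsilon> v" "twist \<epsilon> (u - v) = twist \<epsilon> u - twist \<epsilon> v"
  by (simp_all add: twist_def vec_eq_iff forall_2 algebra_simps)

lemma cross2_twist: "cross2 (twist \<epsilon> u) v = cross2 u v + \<epsilon> * (u \<bullet> v)"
  by (simp add: twist_def cross2_def inner_vec_def sum_2 algebra_simps)

lemma cross2_twist_twist: "cross2 (twist \<epsilon> u) (twist \<epsilon> v) = (1 + \<epsilon>^2) * cross2 u v"
  by (simp add: twist_def cross2_def power2_eq_square algebra_simps)

lemma norm_twist: "norm (twist \<epsilon> v) = sqrt (1 + \<epsilon>^2) * norm v"
proof -
  have "norm (twist \<epsilon> v) = sqrt ((v $ 1 + \<epsilon> * v $ 2)^2 + (v $ 2 - \<epsilon> * v $ 1)^2)"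
    by (simp add: norm_vec_def L2_set_def sum_2 twist_def)
  also have "(v $ 1 + \<epsilon> * v $ 2)^2 + (v $ 2 - \<epsilon> * v $ 1)^2 = (1 + \<epsilon>^2) * ((v $ 1)^2 + (v $ 2)^2)"
    by algebra
  finally show ?thesis by (simp add: real_sqrt_mult norm_vec_def L2_set_def sum_2)
qed

section \<open>Rotated containers of fixed shape\<close>

text \<open>By convexity, containing a triangle means containing the finite set \<open>V\<close> of
  its vertices. Positive orientation costs no generality, since two vertices can be exchanged, and
  it makes \<open>orient\<close> twice the area.\<close>

locale optimal_container =
  fixes V :: "(real^2) set" and X Y Z :: "real^2"
  assumes finite_V: "finite V" and V_nonempty: "V \<noteq> {}"
    and subset: "V \<subseteq> convex hull {X, Y, Z}"
    and positive: "0 < orient X Y Z"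
    and iso: "isosceles X Y Z"
    and optimal: "\<And>P Q R. isosceles P Q R \<Longrightarrow> 0 < orient P Q R \<Longrightarrow>
      V \<subseteq> convex hull {P, Q, R} \<Longrightarrow> orient X Y Z \<le> orient P Q R"
begin

lemma rotate: "optimal_container V Y Z X"
proof
  show "isosceles Y Z X" using iso by (auto simp: isosceles_def)
  show "V \<subseteq> convex hull {Y, Z, X}" using subset by (simp add: insert_commute)
qed (use finite_V V_nonempty positive optimal in \<open>simp_all add: orient_rotate\<close>)

lemma orient_nonneg:
  assumes "v \<in> V" shows "0 \<le> orient Y Z v" "0 \<le> orient Z X v" "0 \<le> orient X Y v"
  using assms subset mem_hull_iff_orient[OF positive] by blast+

text \<open>The three half-planes below bound a triangle directly similar to the container, of area
  proportional to the square of the sum of the three offsets.\<close>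

lemma similar_container_bound:
  assumes m1: "\<And>v. v \<in> V \<Longrightarrow> m1 \<le> cross2 (Z - Y) v + \<epsilon> * ((Z - Y) \<bullet> v)"
    and m2: "\<And>v. v \<in> V \<Longrightarrow> m2 \<le> cross2 (X - Z) v + \<epsilon> * ((X - Z) \<bullet> v)"
    and m3: "\<And>v. v \<in> V \<Longrightarrow> m3 \<le> cross2 (Y - X) v + \<epsilon> * ((Y - X) \<bullet> v)"
    and neg: "m1 + m2 + m3 < 0"
  shows "(orient X Y Z)^2 * (1 + \<epsilon>^2) \<le> (m1 + m2 + m3)^2"
proof -
  define D where "D = orient X Y Z"
  define S where "S = - (m1 + m2 + m3)"
  \<comment> \<open>The turned copy is scaled so that all three of its sides fall on the prescribed
    lines; the linear factor is \<open>\<mu> * sqrt (1 + \<epsilon>^2)\<close>.\<close>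
  define \<nu> where "\<nu> = S / D"
  define \<mu> where "\<mu> = \<nu> / (1 + \<epsilon>^2)"
  have D: "0 < D" using positive by (simp add: D_def)
  have S: "0 < S" using neg by (simp add: S_def)
  have q: "0 < 1 + \<epsilon>^2" by (simp add: add_pos_nonneg)
  have \<mu>: "0 < \<mu>" "\<mu> * (1 + \<epsilon>^2) = \<nu>" using D S q by (simp_all add: \<mu>_def \<nu>_def)
  have "cross2 (Z - Y) (X - Z) = D" by (simp add: D_def orient_def cross2_def algebra_simps)
  then have "cross2 (twist \<epsilon> (Z - Y)) (twist \<epsilon> (X - Z)) \<noteq> 0"
    unfolding cross2_twist_twist using D q by simp
  then obtain t where t1: "cross2 (twist \<epsilon> (Z - Y)) t = m1 - \<nu> * cross2 (Z - Y) Y"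
    and t2: "cross2 (twist \<epsilon> (X - Z)) t = m2 - \<nu> * cross2 (X - Z) Z"
    by (rule cross2_solve)
  have k: "cross2 (Z - Y) Y + cross2 (X - Z) Z + cross2 (Y - X) X = - D"
    by (simp add: D_def orient_def cross2_def algebra_simps)
  \<comment> \<open>The translation \<open>t\<close> fixes only two offsets. The third follows
    because the side vectors sum to zero and \<open>\<nu>\<close> is the quotient of
    \<open>S\<close> by \<open>D\<close>.\<close>
  have "cross2 (twist \<epsilon> (Y - X)) t = - (cross2 (twist \<epsilon> (Z - Y)) t + cross2 (twist \<epsilon> (X - Z)) t)"
    by (simp add: cross2_twist cross2_linear inner_diff_left algebra_simps)
  also have "\<dots> = m3 + S + \<nu> * (cross2 (Z - Y) Y + cross2 (X - Z) Z)"
    unfolding t1 t2 by (simp add: S_def algebra_simps)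
  also have "cross2 (Z - Y) Y + cross2 (X - Z) Z = - D - cross2 (Y - X) X" using k by linarith
  also have "m3 + S + \<nu> * (- D - cross2 (Y - X) X) = m3 - \<nu> * cross2 (Y - X) X"
    using D by (simp add: \<nu>_def right_diff_distrib)
  finally have t3: "cross2 (twist \<epsilon> (Y - X)) t = m3 - \<nu> * cross2 (Y - X) X" .
  define F where "F v = \<mu> *\<^sub>R twist \<epsilon> v + t" for v
  have orientF: "orient (F P) (F Q) w = \<mu> * (cross2 (twist \<epsilon> (Q - P)) w -
      (\<nu> * cross2 (Q - P) P + cross2 (twist \<epsilon> (Q - P)) t))" for P Q w
  proof -
    have "F Q - F P = \<mu> *\<^sub>R twist \<epsilon> (Q - P)" by (simp add: F_def twist_linear scaleR_diff_right)
    then have "orient (F P) (F Q) w = \<mu> * (cross2 (twist \<epsilon> (Q - P)) w - cross2 (twist \<epsilon> (Q - P)) (F P))"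
      by (simp add: orient_def cross2_linear right_diff_distrib)
    also have "cross2 (twist \<epsilon> (Q - P)) (F P) = \<nu> * cross2 (Q - P) P + cross2 (twist \<epsilon> (Q - P)) t"
      unfolding \<mu>(2)[symmetric] by (simp add: F_def cross2_linear(2,8) cross2_twist_twist)
    finally show ?thesis .
  qed
  have area: "orient (F X) (F Y) (F Z) = \<mu>^2 * (1 + \<epsilon>^2) * D"
  proof -
    have "F Y - F X = \<mu> *\<^sub>R twist \<epsilon> (Y - X)" "F Z - F X = \<mu> *\<^sub>R twist \<epsilon> (Z - X)"
      by (simp_all add: F_def twist_linear scaleR_diff_right)
    then show ?thesis
      unfolding D_def orient_def by (simp add: cross2_linear(7,8) cross2_twist_twist power2_eq_square)
  qed
  have distF: "dist (F P) (F Q) = \<mu> * sqrt (1 + \<epsilon>^2) * dist P Q" for P Q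
  proof -
    have "F P - F Q = \<mu> *\<^sub>R twist \<epsilon> (P - Q)"
      by (simp add: F_def twist_linear scaleR_diff_right)
    then show ?thesis using \<mu> by (simp add: dist_norm norm_twist)
  qed
  have pos: "0 < orient (F X) (F Y) (F Z)" unfolding area using D \<mu> q by simp
  have "D \<le> orient (F X) (F Y) (F Z)"
    unfolding D_def
  proof (rule optimal)
    show "isosceles (F X) (F Y) (F Z)" using iso by (auto simp: isosceles_def distF)
    show "V \<subseteq> convex hull {F X, F Y, F Z}"
    proof
      fix v assume v: "v \<in> V"
      show "v \<in> convex hull {F X, F Y, F Z}"
        unfolding mem_hull_iff_orient[OF pos] orientF t1 t2 t3
        using \<mu> m1[OF v] m2[OF v] m3[OF v] by (simp add: cross2_twist)
    qed
  qed (rule pos)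
  then have "1 \<le> \<mu>^2 * (1 + \<epsilon>^2)" unfolding area using D by simp
  then have "D^2 * (1 + \<epsilon>^2) * 1 \<le> D^2 * (1 + \<epsilon>^2) * (\<mu>^2 * (1 + \<epsilon>^2))"
    using q by (intro mult_left_mono) auto
  also have "\<dots> = (D * (\<mu> * (1 + \<epsilon>^2)))^2" by algebra
  also have "\<dots> = S^2" unfolding \<mu>(2) \<nu>_def using D by simp
  finally show ?thesis by (simp add: D_def S_def power2_commute flip: power2_minus[of "m1 + m2 + m3"])
qed

lemma orient_eq_cross2:
  "orient Y Z v = cross2 (Z - Y) v - cross2 (Z - Y) Y"
  "orient Z X v = cross2 (X - Z) v - cross2 (X - Z) Z"
  "orient X Y v = cross2 (Y - X) v - cross2 (Y - X) X"
  by (simp_all add: orient_def cross2_linear)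

lemma cross2_sum: "cross2 (Z - Y) Y + cross2 (X - Z) Z + cross2 (Y - X) X = - orient X Y Z"
  by (simp add: orient_def cross2_def algebra_simps)

text \<open>Otherwise that side could be pushed inwards parallel to itself, giving a smaller
  homothetic container. This is \<open>similar_container_bound\<close> at angle zero.\<close>

lemma side_touched: "\<exists>v\<in>V. orient Y Z v = 0"
proof (rule ccontr)
  assume "\<not> ?thesis"
  then have pos: "0 < orient Y Z v" if "v \<in> V" for v
    using orient_nonneg(1)[OF that] that by force
  \<comment> \<open>The cap at half of \<open>orient X Y Z\<close> keeps the shrunken triangle from
    degenerating.\<close>
  define d where "d = min (Min (orient Y Z ` V)) (orient X Y Z / 2)"
  have d: "0 < d" "d < orient X Y Z" "\<And>v. v \<in> V \<Longrightarrow> d \<le> orient Y Z v"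
    using pos positive finite_V V_nonempty by (auto simp: d_def min_le_iff_disj)
  have s: "(cross2 (Z - Y) Y + d) + cross2 (X - Z) Z + cross2 (Y - X) X = d - orient X Y Z"
    using cross2_sum by simp
  have "(orient X Y Z)^2 * (1 + 0^2) \<le> ((cross2 (Z - Y) Y + d) + cross2 (X - Z) Z + cross2 (Y - X) X)^2"
  proof (rule similar_container_bound)
    fix v assume v: "v \<in> V"
    show "cross2 (Z - Y) Y + d \<le> cross2 (Z - Y) v + 0 * ((Z - Y) \<bullet> v)"
      using d(3)[OF v] unfolding orient_eq_cross2 by simp
    show "cross2 (X - Z) Z \<le> cross2 (X - Z) v + 0 * ((X - Z) \<bullet> v)"
      "cross2 (Y - X) X \<le> cross2 (Y - X) v + 0 * ((Y - X) \<bullet> v)"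
      using orient_nonneg[OF v] unfolding orient_eq_cross2 by simp_all
  qed (use s d in simp)
  then have "(orient X Y Z)^2 \<le> (orient X Y Z - d)^2" unfolding s by (simp add: power2_commute)
  moreover have "(orient X Y Z - d)^2 < (orient X Y Z)^2" using d by (intro power_strict_mono) auto
  ultimately show False by simp
qed

lemma side_flush:
  "\<exists>v\<in>V. \<exists>w\<in>V. v \<noteq> w \<and> (orient Y Z v = 0 \<and> orient Y Z w = 0 \<or>
     orient Z X v = 0 \<and> orient Z X w = 0 \<or> orient X Y v = 0 \<and> orient X Y w = 0)"
proof (rule ccontr)
  assume contra: "\<not> ?thesis"
  interpret Y: optimal_container V Y Z X by (rule rotate)
  interpret Z: optimal_container V Z X Y by (rule Y.rotate)
  obtain v1 v2 v3 where v: "v1 \<in> V" "v2 \<in> V" "v3 \<in> V"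
    "orient Y Z v1 = 0" "orient Z X v2 = 0" "orient X Y v3 = 0"
    using side_touched Y.side_touched Z.side_touched by blast
  define D where "D = orient X Y Z"
  define E where "E = (Z - Y) \<bullet> v1 + (X - Z) \<bullet> v2 + (Y - X) \<bullet> v3"
  have D: "0 < D" using positive by (simp add: D_def)
  have sumD: "cross2 (Z - Y) v1 + cross2 (X - Z) v2 + cross2 (Y - X) v3 = - D"
    using v(4-6) cross2_sum unfolding orient_eq_cross2 D_def by linarith
  \<comment> \<open>A strict minimizer over the finite \<open>V\<close> stays a minimizer for small
    \<open>\<epsilon>\<close>, so the same touching vertices determine the offsets, which are then
    affine in \<open>\<epsilon>\<close>.\<close>
  have ev: "\<forall>\<^sub>F \<epsilon> in nhds 0. \<forall>w\<in>V. cross2 d v + \<epsilon> * (d \<bullet> v) \<le> cross2 d w + \<epsilon> * (d \<bullet> w)"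
    if least: "\<forall>w\<in>V. w = v \<or> cross2 d v < cross2 d w" for d v
  proof (rule eventually_ball_finite[OF finite_V], rule ballI)
    fix w assume "w \<in> V"
    then consider "w = v" | "cross2 d v < cross2 d w" using least \<open>w \<in> V\<close> by blast
    then show "\<forall>\<^sub>F \<epsilon> in nhds 0. cross2 d v + \<epsilon> * (d \<bullet> v) \<le> cross2 d w + \<epsilon> * (d \<bullet> w)"
    proof cases
      case 2
      have "\<forall>\<^sub>F \<epsilon> in nhds 0. cross2 d v + \<epsilon> * (d \<bullet> v) < cross2 d w + \<epsilon> * (d \<bullet> w)"
        by (rule eventually_less_nhds) (use 2 in \<open>auto intro!: continuous_intros\<close>)
      then show ?thesis by (rule eventually_mono) simp
    qed simp
  qed
  have m1: "\<forall>w\<in>V. w = v1 \<or> cross2 (Z - Y) v1 < cross2 (Z - Y) w"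
    using contra v orient_nonneg(1) unfolding orient_eq_cross2 by (metis diff_gt_0_iff_gt eq_iff_diff_eq_0 less_eq_real_def)
  have m2: "\<forall>w\<in>V. w = v2 \<or> cross2 (X - Z) v2 < cross2 (X - Z) w"
    using contra v orient_nonneg(2) unfolding orient_eq_cross2 by (metis diff_gt_0_iff_gt eq_iff_diff_eq_0 less_eq_real_def)
  have m3: "\<forall>w\<in>V. w = v3 \<or> cross2 (Y - X) v3 < cross2 (Y - X) w"
    using contra v orient_nonneg(3) unfolding orient_eq_cross2 by (metis diff_gt_0_iff_gt eq_iff_diff_eq_0 less_eq_real_def)
  have ev4: "\<forall>\<^sub>F \<epsilon> in nhds 0. \<epsilon> * E < D"
    by (rule eventually_less_nhds) (use D in \<open>auto intro!: continuous_intros\<close>)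
  have "\<forall>\<^sub>F \<epsilon> in nhds 0. D^2 * (1 + \<epsilon>^2) \<le> (D - \<epsilon> * E)^2 \<and> \<epsilon> * E < D"
    using ev[OF m1] ev[OF m2] ev[OF m3] ev4
  proof eventually_elim
    case (elim \<epsilon>)
    have s: "(cross2 (Z - Y) v1 + \<epsilon> * ((Z - Y) \<bullet> v1)) + (cross2 (X - Z) v2 + \<epsilon> * ((X - Z) \<bullet> v2)) +
        (cross2 (Y - X) v3 + \<epsilon> * ((Y - X) \<bullet> v3)) = \<epsilon> * E - D"
      using sumD by (simp add: E_def algebra_simps)
    have "D^2 * (1 + \<epsilon>^2) \<le> (\<epsilon> * E - D)^2"
      unfolding s[symmetric] unfolding D_def
      by (rule similar_container_bound) (use elim s in auto)
    then show ?case using elim by (simp add: power2_commute)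
  qed
  then obtain r where r: "0 < r" and
    bound: "\<And>\<epsilon>. \<bar>\<epsilon>\<bar> < r \<Longrightarrow> D^2 * (1 + \<epsilon>^2) \<le> (D - \<epsilon> * E)^2 \<and> \<epsilon> * E < D"
    unfolding eventually_nhds_metric by (auto simp: dist_real_def)
  \<comment> \<open>With \<open>\<epsilon>\<close> the tangent of an angle, the scale is
    \<open>D\<close> times its cosine minus \<open>E\<close> times its sine, divided by
    \<open>D\<close>. For this sign of \<open>\<epsilon>\<close> the \<open>E\<close> term does not
    increase it, while the cosine is below 1.\<close>
  define \<epsilon> where "\<epsilon> = (if 0 \<le> E then r / 2 else - (r / 2))"
  have \<epsilon>: "\<bar>\<epsilon>\<bar> < r" "\<epsilon> \<noteq> 0" "0 \<le> \<epsilon> * E" using r by (auto simp: \<epsilon>_def mult_le_0_iff)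
  have "(D - \<epsilon> * E)^2 \<le> D^2" using \<epsilon> bound[of \<epsilon>] by (intro power_mono) auto
  with bound[of \<epsilon>] \<epsilon> have "D^2 * (1 + \<epsilon>^2) \<le> D^2" by linarith
  then show False using D \<epsilon> by (simp add: algebra_simps mult_le_0_iff)
qed

section \<open>From coordinates back to the plane\<close>

text \<open>The positive factor \<open>k\<close> puts both third vertices on one ray from
  \<open>p\<close>, which encodes equal angles at \<open>p\<close> without trigonometry. Set
  equations are used because the order of the vertices depends on the case.\<close>

lemma shares_side_and_angle_of_flush:
  assumes V: "V = {A, B, C}" and noncollinear: "orient A B C \<noteq> 0"
    and A: "orient Y Z A = 0" and B: "orient Y Z B = 0"
  shows "\<exists>p q r r' k. V = {p, q, r} \<and> {X, Y, Z} = {p, q, r'} \<and> 0 < k \<and> r' - p = k *\<^sub>R (r - p)"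
proof -
  interpret RY: optimal_container V Y Z X by (rule rotate)
  interpret RZ: optimal_container V Z X Y by (rule RY.rotate)
  have YZ: "Y \<noteq> Z" using positive by (auto simp: orient_def cross2_def)
  define z where "z = dist Y Z"
  have z: "0 < z" using YZ by (simp add: z_def)
  define e where "e = (1 / z) *\<^sub>R (Z - Y)"
  have "norm e = 1" using z by (simp add: e_def z_def dist_norm norm_minus_commute)
  then have "sqrt ((e $ 1)^2 + (e $ 2)^2) = 1" by (simp add: norm_vec_def L2_set_def sum_2)
  then have e: "(e $ 1)^2 + (e $ 2)^2 = 1" by simp
  \<comment> \<open>Orthonormal, positively oriented coordinates with origin \<open>Y\<close> and
    \<open>Z\<close> on the positive first axis.\<close>
  define F where "F u v = Y + (vector [u * e $ 1 - v * e $ 2, u * e $ 2 + v * e $ 1] :: real^2)" for u v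
  have F0: "F 0 0 = Y" by (simp add: F_def vec_eq_iff forall_2)
  have Fz: "F z 0 = Z"
  proof -
    have "z *\<^sub>R e = Z - Y" using z by (simp add: e_def)
    then show ?thesis by (simp add: F_def vec_eq_iff forall_2)
  qed
  have F_diff: "F u' v' - F u v = k *\<^sub>R (F u'' v'' - F u v)"
    if "u' - u = k * (u'' - u)" "v' - v = k * (v'' - v)" for u v u' v' u'' v'' k
  proof -
    have *: "u' = u + k * (u'' - u)" "v' = v + k * (v'' - v)" using that by auto
    show ?thesis unfolding * by (simp add: F_def vec_eq_iff forall_2 algebra_simps)
  qed
  have orientF: "orient (F p1 p2) (F q1 q2) (F r1 r2) = area2 p1 p2 q1 q2 r1 r2" for p1 p2 q1 q2 r1 r2
  proof -
    have "orient (F p1 p2) (F q1 q2) (F r1 r2) = ((e $ 1)^2 + (e $ 2)^2) * area2 p1 p2 q1 q2 r1 r2"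
      by (simp add: orient_def cross2_def F_def area2_def power2_eq_square algebra_simps)
    then show ?thesis by (simp add: e)
  qed
  have distF: "dist (F p1 p2) (F q1 q2) = sqrt ((q1 - p1)^2 + (q2 - p2)^2)" for p1 p2 q1 q2
  proof -
    have "dist (F p1 p2) (F q1 q2) = sqrt (((q1 * e $ 1 - q2 * e $ 2) - (p1 * e $ 1 - p2 * e $ 2))^2 +
        ((q1 * e $ 2 + q2 * e $ 1) - (p1 * e $ 2 + p2 * e $ 1))^2)"
      by (simp add: dist_norm norm_vec_def L2_set_def sum_2 F_def) (simp only: power2_commute)
    also have "((q1 * e $ 1 - q2 * e $ 2) - (p1 * e $ 1 - p2 * e $ 2))^2 +
        ((q1 * e $ 2 + q2 * e $ 1) - (p1 * e $ 2 + p2 * e $ 1))^2 =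
        ((e $ 1)^2 + (e $ 2)^2) * ((q1 - p1)^2 + (q2 - p2)^2)"
      by algebra
    finally show ?thesis by (simp add: e)
  qed
  have coord: "\<exists>u v. P = F u v" for P
  proof (intro exI)
    define w where "w = P - Y"
    have "w $ 1 * ((e $ 1)^2 + (e $ 2)^2) = w $ 1" "w $ 2 * ((e $ 1)^2 + (e $ 2)^2) = w $ 2" by (simp_all add: e)
    then have "P - Y = F (w $ 1 * e $ 1 + w $ 2 * e $ 2) (w $ 2 * e $ 1 - w $ 1 * e $ 2) - Y"
      unfolding w_def[symmetric] by (simp add: F_def vec_eq_iff forall_2 power2_eq_square algebra_simps)
    then show "P = F (w $ 1 * e $ 1 + w $ 2 * e $ 2) (w $ 2 * e $ 1 - w $ 1 * e $ 2)" by simp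
  qed
  obtain x y where X: "X = F x y" using coord by blast
  have area: "orient X Y Z = z * y" by (simp add: X orientF area2_def algebra_simps flip: F0 Fz)
  then have y: "0 < y" using positive z by (simp add: zero_less_mult_iff)
  obtain c h where C: "C = F c h" using coord by blast
  have on_axis: "\<exists>a. P = F a 0" if "orient Y Z P = 0" for P
  proof -
    obtain a b where P: "P = F a b" using coord by blast
    then have "z * b = 0" using that by (simp add: orientF area2_def flip: F0 Fz)
    then show ?thesis using z P by auto
  qed
  have "\<exists>a b. a < b \<and> V = {F a 0, F b 0, C}"
  proof -
    obtain a b where AB: "A = F a 0" "B = F b 0" using on_axis A B by blast
    have "a \<noteq> b" using noncollinear by (auto simp: AB orient_def cross2_def)
    then consider "a < b" | "b < a" by linarith
    then show ?thesis unfolding V AB by cases blast+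
  qed
  then obtain a b where ab: "a < b" and Vab: "V = {F a 0, F b 0, C}" by blast
  have h: "h \<noteq> 0"
  proof
    assume "h = 0"
    obtain a' b' where AB: "A = F a' 0" "B = F b' 0" using on_axis A B by blast
    show False using noncollinear \<open>h = 0\<close> by (simp add: AB C orientF area2_def)
  qed
  have in_V: "F a 0 \<in> V" "F b 0 \<in> V" "F c h \<in> V" using Vab C by auto
  have sides: "orient Y Z (F u v) = z * v" "orient Z X (F u v) = (x - z) * v - (u - z) * y"
    "orient X Y (F u v) = u * y - x * v" for u v
    by (simp_all add: X orientF area2_def algebra_simps flip: F0 Fz)
  interpret flush_position a b c h x y z
  proof
    show "0 < h" using orient_nonneg(1)[OF in_V(3)] h z unfolding sides by (simp add: zero_le_mult_iff)
    show "0 \<le> a" using orient_nonneg(3)[OF in_V(1)] y unfolding sides by (simp add: zero_le_mult_iff)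
    show "b \<le> z" using orient_nonneg(2)[OF in_V(2)] y unfolding sides by (simp add: mult_le_0_iff)
    show "x * h \<le> c * y" "(c - z) * y \<le> (x - z) * h"
      using orient_nonneg[OF in_V(3)] unfolding sides by simp_all
    \<comment> \<open>Some vertex touches the side from \<open>X\<close> to \<open>Y\<close>; both
      vertices on the axis have positive abscissa, so only \<open>C\<close> can.\<close>
    show "c * y = x * h" if "0 < a"
      using RZ.side_touched that y ab unfolding Vab C by (auto simp: sides)
    show "(c - z) * y = (x - z) * h" if "b < z"
      using RY.side_touched that y ab unfolding Vab C by (auto simp: sides)
  next
    fix p1 p2 q1 q2 r1 r2
    assume eq: "(q1 - p1)^2 + (q2 - p2)^2 = (r1 - p1)^2 + (r2 - p2)^2"
      and pos: "0 < area2 p1 p2 q1 q2 r1 r2"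
      and ins: "inside p1 p2 q1 q2 r1 r2 a 0" "inside p1 p2 q1 q2 r1 r2 b 0" "inside p1 p2 q1 q2 r1 r2 c h"
    have pos': "0 < orient (F p1 p2) (F q1 q2) (F r1 r2)" using pos by (simp add: orientF)
    have "orient X Y Z \<le> orient (F p1 p2) (F q1 q2) (F r1 r2)"
    proof (rule optimal)
      show "isosceles (F p1 p2) (F q1 q2) (F r1 r2)" using eq by (simp add: isosceles_def distF)
      show "V \<subseteq> convex hull {F p1 p2, F q1 q2, F r1 r2}"
        using ins unfolding Vab C by (auto simp: mem_hull_iff_orient[OF pos'] orientF inside_def)
    qed (rule pos')
    then show "z * y \<le> area2 p1 p2 q1 q2 r1 r2" unfolding area orientF .
  qed (use y z ab in auto)
  have "2 * x = z \<or> x^2 + y^2 = z^2 \<or> (x - z)^2 + y^2 = z^2"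
  proof -
    \<comment> \<open>Equal sides meeting at \<open>X\<close> put \<open>X\<close> above the
      midpoint of the axis side, the condition \<open>2 * x = z\<close>.\<close>
    have "x^2 + y^2 = (x - z)^2 + y^2 \<longleftrightarrow> z * z = z * (2 * x)"
      by (auto simp: power2_eq_square algebra_simps)
    then have base: "x^2 + y^2 = (x - z)^2 + y^2 \<longleftrightarrow> 2 * x = z" using z by auto
    have d: "dist X Y = sqrt (x^2 + y^2)" "dist X Z = sqrt ((x - z)^2 + y^2)" "dist Y Z = sqrt (z^2)"
      unfolding X F0[symmetric] Fz[symmetric] distF by (simp_all add: power2_commute)
    show ?thesis
      using iso base unfolding isosceles_def dist_commute[of Z] dist_commute[of Y X] d real_sqrt_eq_iff by metis
  qed
  from shares_side_and_angle[OF this] consider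
      "a = 0" "b = z" "c * y = x * h" | "a = 0" "b = z" "(c - z) * y = (x - z) * h"
    | "a = 0" "c = x" "h = y" | "b = z" "c = x" "h = y"
    by blast
  then show ?thesis
  proof cases
    case 1
    have "X - Y = (y / h) *\<^sub>R (C - Y)"
      unfolding X C F0[symmetric] using 1 h by (intro F_diff) (auto simp: field_simps)
    moreover have "V = {Y, Z, C}" using Vab 1 F0 Fz by simp
    ultimately show ?thesis using y_pos h_pos
      by (intro exI[of _ Y] exI[of _ Z] exI[of _ C] exI[of _ X] exI[of _ "y / h"]) auto
  next
    case 2
    have "X - Z = (y / h) *\<^sub>R (C - Z)"
      unfolding X C Fz[symmetric] using 2 h by (intro F_diff) (auto simp: field_simps)
    moreover have "V = {Z, Y, C}" using Vab 2 F0 Fz by auto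
    ultimately show ?thesis using y_pos h_pos
      by (intro exI[of _ Z] exI[of _ Y] exI[of _ C] exI[of _ X] exI[of _ "y / h"]) auto
  next
    case 3
    have "Z - Y = (z / b) *\<^sub>R (F b 0 - Y)"
      unfolding F0[symmetric] Fz[symmetric] using 3 ab by (intro F_diff) auto
    moreover have "V = {Y, X, F b 0}" using Vab 3 F0 C X by auto
    ultimately show ?thesis using z_pos ab 3
      by (intro exI[of _ Y] exI[of _ X] exI[of _ "F b 0"] exI[of _ Z] exI[of _ "z / b"]) auto
  next
    case 4
    have "Y - Z = (z / (z - a)) *\<^sub>R (F a 0 - Z)"
      unfolding F0[symmetric] Fz[symmetric] using 4 ab by (intro F_diff) (auto simp: field_simps)
    moreover have "V = {Z, X, F a 0}" using Vab 4 Fz C X by auto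
    ultimately show ?thesis using z_pos ab 4
      by (intro exI[of _ Z] exI[of _ X] exI[of _ "F a 0"] exI[of _ Y] exI[of _ "z / (z - a)"]) auto
  qed
qed

end

lemma optimal_container_shares_side_and_angle:
  assumes opt: "optimal_container V X Y Z" and V: "V = {A, B, C}" and ncol: "\<not> collinear V"
  shows "\<exists>p q r r' k. V = {p, q, r} \<and> {X, Y, Z} = {p, q, r'} \<and> 0 < k \<and> r' - p = k *\<^sub>R (r - p)"
proof -
  interpret optimal_container V X Y Z by (rule opt)
  interpret RY: optimal_container V Y Z X by (rule rotate)
  interpret RZ: optimal_container V Z X Y by (rule RY.rotate)
  obtain v w where vw: "v \<in> V" "w \<in> V" "v \<noteq> w" and
    flush: "orient Y Z v = 0 \<and> orient Y Z w = 0 \<or> orient Z X v = 0 \<and> orient Z X w = 0 \<or>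
      orient X Y v = 0 \<and> orient X Y w = 0"
    using side_flush by blast
  obtain u where u: "V = {v, w, u}" using vw unfolding V by blast
  have ncol': "orient v w u \<noteq> 0" using ncol unfolding u collinear_iff_orient .
  have perm: "{Y, Z, X} = {X, Y, Z}" "{Z, X, Y} = {X, Y, Z}" by auto
  from flush show ?thesis
  proof (elim disjE conjE)
    assume "orient Y Z v = 0" "orient Y Z w = 0"
    then show ?thesis by (rule shares_side_and_angle_of_flush[OF u ncol'])
  next
    assume "orient Z X v = 0" "orient Z X w = 0"
    then show ?thesis by (rule RY.shares_side_and_angle_of_flush[OF u ncol', unfolded perm])
  next
    assume "orient X Y v = 0" "orient X Y w = 0"
    then show ?thesis by (rule RZ.shares_side_and_angle_of_flush[OF u ncol', unfolded perm])
  qed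
qed

section \<open>Regions, areas and angles\<close>

lemma angle_at_scaleR:
  assumes "0 < k" "r' - p = k *\<^sub>R (r - p)"
  shows "angle_at q p r' = angle_at q p r"
  using assms by (simp add: angle_at_def)

text \<open>Exchanging two vertices makes the container positively oriented; area comparison of
  regions then becomes comparison of \<open>orient\<close>, and a convex hull contains
  \<open>T\<close> as soon as it contains its vertices.\<close>

lemma min_area_isosceles_container_optimal:
  assumes T: "triangle_with_vertices T A B C" and min: "min_area_isosceles_container T T'"
  obtains X Y Z where "triangle_with_vertices T' X Y Z" "optimal_container {A, B, C} X Y Z"
proof -
  have T': "T \<subseteq> T'" "isosceles_triangle T'" using min
    by (auto simp: min_area_isosceles_container_def isosceles_container_def)
  then obtain X Y Z where XYZ: "triangle_with_vertices T' X Y Z" "isosceles X Y Z"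
    by (auto simp: isosceles_triangle_def isosceles_def)
  then have "orient X Y Z \<noteq> 0" by (simp add: triangle_with_vertices_def collinear_iff_orient)
  then consider "0 < orient X Y Z" | "0 < orient X Z Y" using orient_swap[of X Z Y] by linarith
  then have "\<exists>X Y Z. triangle_with_vertices T' X Y Z \<and> isosceles X Y Z \<and> 0 < orient X Y Z"
  proof cases
    case 2
    have "triangle_with_vertices T' X Z Y" "isosceles X Z Y"
      using XYZ by (auto simp: triangle_with_vertices_def isosceles_def insert_commute dist_commute)
    with 2 show ?thesis by blast
  qed (use XYZ in blast)
  then obtain X Y Z where XYZ: "triangle_with_vertices T' X Y Z" "isosceles X Y Z" and pos: "0 < orient X Y Z"
    by blast
  have hull: "T = convex hull {A, B, C}" "T' = convex hull {X, Y, Z}"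
    using T XYZ by (auto simp: triangle_with_vertices_def)
  have "optimal_container {A, B, C} X Y Z"
  proof
    show "{A, B, C} \<subseteq> convex hull {X, Y, Z}"
      using hull_subset[of "{A, B, C}" convex] T'(1) unfolding hull by (rule order_trans)
    fix P Q R
    assume PQR: "isosceles P Q R" "0 < orient P Q R" "{A, B, C} \<subseteq> convex hull {P, Q, R}"
    have ncol: "\<not> collinear {P, Q, R}" using PQR(2) by (simp add: collinear_iff_orient)
    have perm: "{Q, R, P} = {P, Q, R}" "{R, P, Q} = {P, Q, R}" by auto
    have "triangle_with_vertices (convex hull {P, Q, R}) P Q R" "triangle_with_vertices (convex hull {P, Q, R}) Q R P"
      "triangle_with_vertices (convex hull {P, Q, R}) R P Q"
      using ncol by (simp_all add: triangle_with_vertices_def perm)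
    then have "isosceles_triangle (convex hull {P, Q, R})"
      using PQR(1) unfolding isosceles_def isosceles_triangle_def by blast
    moreover have "T \<subseteq> convex hull {P, Q, R}" unfolding hull using PQR(3) by (simp add: hull_minimal)
    ultimately have "measure lborel T' \<le> measure lborel (convex hull {P, Q, R})"
      using min by (simp add: min_area_isosceles_container_def isosceles_container_def)
    then show "orient X Y Z \<le> orient P Q R" using pos PQR(2) by (simp add: hull measure_eq_orient)
  qed (use pos XYZ in auto)
  then show thesis using that XYZ by blast
qed

theorem theorem1p2:
  fixes T T' :: "(real^2) set"
  assumes "is_triangle T"
    and "min_area_isosceles_container T T'"
  shows "\<exists>p q r r'. triangle_with_vertices T p q r \<and> triangle_with_vertices T' p q r' \<and>
           angle_at q p r = angle_at q p r'"
proof -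
  obtain A B C where T: "triangle_with_vertices T A B C"
    using assms(1) by (auto simp: is_triangle_def)
  then obtain X Y Z where T': "triangle_with_vertices T' X Y Z" and opt: "optimal_container {A, B, C} X Y Z"
    using assms(2) by (rule min_area_isosceles_container_optimal)
  have ncol: "\<not> collinear {A, B, C}" using T by (simp add: triangle_with_vertices_def)
  obtain p q r r' k where eq: "{A, B, C} = {p, q, r}" "{X, Y, Z} = {p, q, r'}"
    and k: "0 < k" "r' - p = k *\<^sub>R (r - p)"
    using optimal_container_shares_side_and_angle[OF opt refl ncol] by blast
  have "triangle_with_vertices T p q r" "triangle_with_vertices T' p q r'"
    using T T' eq by (simp_all add: triangle_with_vertices_def)
  then show ?thesis using angle_at_scaleR[OF k] by metis
qed

end
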